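(* Let $\varphi$ and $\varphi_\lambda$ ($\lambda>0$) be the probability function and its inner regularization defined in the context, where $\xi$ has a density with respect to Lebesgue measure and $\Phi$ is continuous. Then $\varphi_\lambda$ hypo-converges to $\varphi$ as $\lambda\searrow0$; that is, for every sequence $\lambda_k\searrow0$, $\varphi_{\lambda_k}$ hypo-converges to $\varphi$. If, in addition, $h$ is weakly continuous, then $\varphi_\lambda$ Mosco hypo-converges to $\varphi$ as $\lambda\searrow0$.
   Context: $\mathcal H$ is a separable real Hilbert space; $\mathcal Y$ is a (possibly nonseparable) real Banach space with dual $\mathcal Y^*$; $\mathcal H\times\mathbb R^m$ carries the product inner product. $\mathcal K\subset\mathcal Y$ is a nonempty convex cone and $\mathcal K^+:=\{v^*\in\mathcal Y^*:\langle v^*,v\rangle\ge0\ \forall v\in\mathcal K\}$. $\mathcal C\subset\mathcal Y^*$ is a weak$^*$-compact convex set with $\operatorname{cl}^{w^*}\operatorname{cone}\mathcal C=\mathcal K^+$, where $\operatorname{cone}\mathcal C=\{tc:t\ge0,c\in\mathcal C\}$. $\Phi:\mathcal H\times\mathbb R^m\to\mathcal Y$ is continuous, and $h:\mathcal H\to\mathbb R$ is a continuously differentiable convex function such that for every $v^*\in\mathcal C$ the function $(x,z)\mapsto\langle v^*,\Phi(x,z)\rangle+h(x)$ is convex on $\mathcal H\times\mathbb R^m$. Supremum function: $S^h_\Phi(x,z):=\sup\{\langle v^*,\Phi(x,z)\rangle+h(x): v^*\in\mathcal C\}$. Moreau envelope: for a proper convex lower semicontinuous function $f$ on a Hilbert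 space $X$ and $\lambda>0$, $\mathrm e_\lambda f(u):=\inf_{w\in X}\left(f(w)+\frac1{2\lambda}\|u-w\|^2\right)$. Here $\mathrm e_\lambda S^h_\Phi$ is taken on $X=\mathcal H\times\mathbb R^m$. $\xi:\Omega\to\mathbb R^m$ is a random vector on a probability space $(\Omega,\mathcal F,\mathbb P)$. Define $\varphi(x):=\mathbb P(\omega:\Phi(x,\xi(\omega))\in-\mathcal K)$ and $\varphi_\lambda(x):=\mathbb P(\omega:\mathrm e_\lambda S^h_\Phi(x,\xi(\omega))\le h(x))$. A sequence $\psi_k:\mathcal H\to\mathbb R$ hypo-converges to $\psi$ if: (i) for all $x\in\mathcal H$ there exist $x_k\to x$ with $\liminf_k\psi_k(x_k)\ge\psi(x)$; and (ii) for all $x\in\mathcal H$ and all $x_k\to x$ (in norm), $\limsup_k\psi_k(x_k)\le\psi(x)$. It Mosco hypo-converges to $\psi$ if (i) holds (with norm convergence) and (ii) holds for all weakly convergent $x_k\rightharpoonup x$.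
   Formalization: The convex cone K is additionally assumed closed; without this the claim fails, e.g. K = {(a,b): a>0} ∪ {0} in R^2, C = {(1,0)}, Φ ≡ (0,1), h = 0 gives φ_λ ≡ 1 but φ ≡ 0. *)

theory Defs
  imports "HOL-Probability.Probability"
begin

text \<open>On the dual of a normed space, the strong operator topology of the library is the topology
  of pointwise convergence of functionals, i.e. the weak* topology.\<close>

abbreviation weak_star_topology :: "('y::real_normed_vector \<Rightarrow>\<^sub>L real) topology"
  where "weak_star_topology \<equiv> strong_operator_topology"

text \<open>The coarsest topology making all bounded linear functionals continuous: \<open>euclidean\<close> on a
  function type is the product topology.\<close>

definition weak_topology :: "'a::real_normed_vector topology"
  where "weak_topology = pullback_topology UNIV (\<lambda>x (f :: 'a \<Rightarrow>\<^sub>L real). blinfun_apply f x) euclidean"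

lemma limitin_weak_topology:
  "limitin weak_topology xs x F \<longleftrightarrow>
    (\<forall>f :: 'a::real_normed_vector \<Rightarrow>\<^sub>L real. ((\<lambda>k. f (xs k)) \<longlongrightarrow> f x) F)"
proof -
  let ?e = "\<lambda>x (f :: 'a \<Rightarrow>\<^sub>L real). blinfun_apply f x"
  have "limitin weak_topology xs x F \<longleftrightarrow> ((\<lambda>k. ?e (xs k)) \<longlongrightarrow> ?e x) F"
    unfolding limitin_def tendsto_def weak_topology_def openin_pullback_topology
      topspace_pullback_topology
    by auto
  also have "\<dots> \<longleftrightarrow> (\<forall>f. ((\<lambda>k. ?e (xs k) f) \<longlongrightarrow> ?e x f) F)"
    using limitin_componentwise[of "\<lambda>_::'a \<Rightarrow>\<^sub>L real. euclidean :: real topology" UNIV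
        "\<lambda>k. ?e (xs k)" "?e x" F]
    unfolding euclidean_product_topology by simp
  finally show ?thesis .
qed

definition dual_cone :: "'y::real_normed_vector set \<Rightarrow> ('y \<Rightarrow>\<^sub>L real) set"
  where "dual_cone K = {v. \<forall>y\<in>K. 0 \<le> blinfun_apply v y}"

definition generated_cone :: "'a::real_vector set \<Rightarrow> 'a set"
  where "generated_cone C = {t *\<^sub>R c | t c. 0 \<le> t \<and> c \<in> C}"

definition continuously_differentiable :: "('a::real_normed_vector \<Rightarrow> real) \<Rightarrow> bool"
  where "continuously_differentiable f \<longleftrightarrow>
    (\<exists>f' :: 'a \<Rightarrow> 'a \<Rightarrow>\<^sub>L real.
       (\<forall>x. (f has_derivative blinfun_apply (f' x)) (at x)) \<and> continuous_on UNIV f')"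

text \<open>Suprema and infima are taken in the extended reals, so that no boundedness has to be
  presupposed.\<close>

definition supremum_function ::
  "('y::real_normed_vector \<Rightarrow>\<^sub>L real) set \<Rightarrow> ('h \<times> 'z \<Rightarrow> 'y) \<Rightarrow> ('h \<Rightarrow> real) \<Rightarrow> 'h \<times> 'z \<Rightarrow> ereal"
  where "supremum_function C \<Phi> h = (\<lambda>(x, z). SUP v\<in>C. ereal (blinfun_apply v (\<Phi> (x, z)) + h x))"

definition moreau_envelope :: "real \<Rightarrow> ('a::real_inner \<Rightarrow> ereal) \<Rightarrow> 'a \<Rightarrow> ereal"
  where "moreau_envelope lam f u = (INF w. f w + ereal (1 / (2 * lam) * (norm (u - w))\<^sup>2))"

definition probability_function ::
  "'\<omega> measure \<Rightarrow> ('\<omega> \<Rightarrow> 'z) \<Rightarrow> ('h \<times> 'z \<Rightarrow> 'y::real_normed_vector) \<Rightarrow> 'y set \<Rightarrow> 'h \<Rightarrow> real"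
  where "probability_function M \<xi> \<Phi> K x = measure M {\<omega> \<in> space M. \<Phi> (x, \<xi> \<omega>) \<in> uminus ` K}"

definition inner_regularization ::
  "'\<omega> measure \<Rightarrow> ('\<omega> \<Rightarrow> 'z::real_inner) \<Rightarrow> ('h::real_inner \<times> 'z \<Rightarrow> 'y::real_normed_vector) \<Rightarrow>
   ('y \<Rightarrow>\<^sub>L real) set \<Rightarrow> ('h \<Rightarrow> real) \<Rightarrow> real \<Rightarrow> 'h \<Rightarrow> real"
  where "inner_regularization M \<xi> \<Phi> C h lam x =
    measure M {\<omega> \<in> space M.
      moreau_envelope lam (supremum_function C \<Phi> h) (x, \<xi> \<omega>) \<le> ereal (h x)}"

definition hypo_converges :: "(nat \<Rightarrow> 'h::real_normed_vector \<Rightarrow> real) \<Rightarrow> ('h \<Rightarrow> real) \<Rightarrow> bool"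
  where "hypo_converges \<psi>s \<psi> \<longleftrightarrow>
    (\<forall>x. \<exists>xs. xs \<longlonglongrightarrow> x \<and> ereal (\<psi> x) \<le> liminf (\<lambda>k. ereal (\<psi>s k (xs k)))) \<and>
    (\<forall>x xs. xs \<longlonglongrightarrow> x \<longrightarrow> limsup (\<lambda>k. ereal (\<psi>s k (xs k))) \<le> ereal (\<psi> x))"

definition mosco_hypo_converges :: "(nat \<Rightarrow> 'h::real_normed_vector \<Rightarrow> real) \<Rightarrow> ('h \<Rightarrow> real) \<Rightarrow> bool"
  where "mosco_hypo_converges \<psi>s \<psi> \<longleftrightarrow>
    (\<forall>x. \<exists>xs. xs \<longlonglongrightarrow> x \<and> ereal (\<psi> x) \<le> liminf (\<lambda>k. ereal (\<psi>s k (xs k)))) \<and>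
    (\<forall>x xs. limitin weak_topology xs x sequentially \<longrightarrow>
       limsup (\<lambda>k. ereal (\<psi>s k (xs k))) \<le> ereal (\<psi> x))"

end

theory Submission
  imports Defs
begin

text \<open>
  The event defining \<open>\<phi>\<close> is \<open>S(x, \<xi>) \<le> h(x)\<close>, by the bipolar theorem for \<open>K\<close>. As the envelope
  lies below \<open>S\<close>, this event is contained in the one defining \<open>\<phi>\<^sub>\<lambda>\<close>, so constant sequences are
  recovery sequences. For the limsup inequality, a subgradient \<open>p\<close> at \<open>u\<close> of
  \<open>f\<^sub>v = \<langle>v, \<Phi>\<rangle> + h \<le> S\<close> yields the bound
  \<open>e\<^sub>\<lambda>S(u') \<ge> f\<^sub>v(u) + p(u' - u) - \<lambda>\<parallel>p\<parallel>\<^sup>2 / 2\<close>, whose right-hand side converges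
  to \<open>f\<^sub>v(u)\<close> when \<open>u'\<close> tends weakly to \<open>u\<close> and \<open>\<lambda>\<close> tends to \<open>0\<close>. Hence the upper limit of the
  regularized events is contained in the original event, and the reverse Fatou lemma concludes.
\<close>

subsection \<open>Sublinear functionals and the Hahn-Banach theorem\<close>

text \<open>Homogeneity is required only as an inequality for \<open>c > 0\<close>, which is easy to
  check for infima. Applying it to \<open>1 / c\<close> as well gives equality, and the value 0 at 0
  follows.\<close>

definition sublinear :: "('a::real_vector \<Rightarrow> real) \<Rightarrow> bool"
  where "sublinear p \<longleftrightarrow>
    (\<forall>x y. p (x + y) \<le> p x + p y) \<and> (\<forall>c x. 0 < c \<longrightarrow> p (c *\<^sub>R x) \<le> c * p x)"

lemma sublinear_add: "sublinear p \<Longrightarrow> p (x + y) \<le> p x + p y"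
  by (simp add: sublinear_def)

lemma sublinear_zero:
  assumes "sublinear p" shows "p 0 = 0"
proof -
  have "p 0 \<le> c * p 0" if "0 < c" for c
    using assms that unfolding sublinear_def by (metis scaleR_zero_right)
  from this[of 2] this[of "1/2"] show ?thesis by simp
qed

lemma sublinear_scaleR:
  assumes "sublinear p" "0 \<le> c" shows "p (c *\<^sub>R x) = c * p x"
proof (cases "c = 0")
  case True
  then show ?thesis by (simp add: sublinear_zero assms)
next
  case False
  with assms have c: "0 < c" by simp
  then have "p ((1 / c) *\<^sub>R (c *\<^sub>R x)) \<le> (1 / c) * p (c *\<^sub>R x)"
    using assms(1) unfolding sublinear_def by (meson zero_less_divide_1_iff)
  then have "c * p x \<le> p (c *\<^sub>R x)" using c by (simp add: field_simps)
  moreover have "p (c *\<^sub>R x) \<le> c * p x" using assms(1) c unfolding sublinear_def by blast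
  ultimately show ?thesis by simp
qed

lemma sublinear_lower:
  assumes "sublinear p" shows "- p (- x) \<le> p x"
  using sublinear_add[OF assms, of x "- x"] sublinear_zero[OF assms] by simp

text \<open>The minorant \<open>m\<close> keeps all real infima meaningful. The index that serves a
  sum or a multiple may depend on the points, so one criterion covers shifts, chains, distances to
  cones and directional derivatives.\<close>

lemma sublinear_INF:
  assumes ne: "A \<noteq> {}"
    and lower: "\<And>x a. a \<in> A \<Longrightarrow> m x \<le> F a x"
    and add: "\<And>a b x y. a \<in> A \<Longrightarrow> b \<in> A \<Longrightarrow> \<exists>c\<in>A. F c (x + y) \<le> F a x + F b y"
    and scale: "\<And>a c x. a \<in> A \<Longrightarrow> 0 < c \<Longrightarrow> \<exists>b\<in>A. F b (c *\<^sub>R x) \<le> c * F a x"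
  shows "sublinear (\<lambda>x. INF a\<in>A. F a x)"
proof -
  have bdd: "bdd_below ((\<lambda>a. F a x) ` A)" for x
    using lower by (intro bdd_belowI2)
  have le: "(INF a\<in>A. F a x) \<le> F a x" if "a \<in> A" for a x
    by (rule cINF_lower[OF bdd that])
  have "(INF a\<in>A. F a (x + y)) \<le> (INF a\<in>A. F a x) + (INF a\<in>A. F a y)" for x y
  proof -
    \<comment> \<open>The two infima on the right are taken one after the other, first over
      \<open>b\<close> with \<open>a\<close> fixed, then over \<open>a\<close>.\<close>
    have 1: "(INF c\<in>A. F c (x + y)) - F a x \<le> F b y" if ab: "a \<in> A" "b \<in> A" for a b
    proof -
      obtain c where "c \<in> A" "F c (x + y) \<le> F a x + F b y" using add[OF ab] by blast
      with le[of c "x + y"] show ?thesis by simp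
    qed
    have "(INF c\<in>A. F c (x + y)) - F a x \<le> (INF b\<in>A. F b y)" if "a \<in> A" for a
      using 1[OF that] by (intro cINF_greatest[OF ne])
    then have "(INF c\<in>A. F c (x + y)) - (INF b\<in>A. F b y) \<le> (INF a\<in>A. F a x)"
      by (intro cINF_greatest[OF ne]) (simp add: algebra_simps)
    then show ?thesis by simp
  qed
  moreover have "(INF a\<in>A. F a (c *\<^sub>R x)) \<le> c * (INF a\<in>A. F a x)" if c: "0 < c" for c x
  proof -
    have "(INF b\<in>A. F b (c *\<^sub>R x)) / c \<le> F a x" if a: "a \<in> A" for a
    proof -
      obtain b where "b \<in> A" "F b (c *\<^sub>R x) \<le> c * F a x" using scale[OF a c] by blast
      with le[of b "c *\<^sub>R x"] show ?thesis using c by (simp add: field_simps)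
    qed
    then have "(INF b\<in>A. F b (c *\<^sub>R x)) / c \<le> (INF a\<in>A. F a x)"
      by (intro cINF_greatest[OF ne])
    then show ?thesis using c by (simp add: field_simps)
  qed
  ultimately show ?thesis unfolding sublinear_def by blast
qed

text \<open>The choice \<open>t = 0\<close> gives \<open>r <= q\<close>, and \<open>t = 1\<close>
  gives \<open>r (- y) <= - q y\<close>. Hence a linear functional below \<open>r\<close> is below
  \<open>q\<close> and agrees with \<open>q\<close> at \<open>y\<close>.\<close>

lemma sublinear_shift:
  fixes y :: "'a::real_vector"
  assumes q: "sublinear q"
  defines "r \<equiv> \<lambda>x. INF t\<in>{0..}. q (x + t *\<^sub>R y) - t * q y"
  shows "sublinear r" and "0 \<le> t \<Longrightarrow> r x \<le> q (x + t *\<^sub>R y) - t * q y"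
proof -
  \<comment> \<open>Subadditivity applied to \<open>t y = (x + t y) + (- x)\<close> bounds the
    expression below independently of \<open>t\<close>.\<close>
  have lower: "- q (- x) \<le> q (x + t *\<^sub>R y) - t * q y" if "t \<in> {0..}" for x t
    using sublinear_add[OF q, of "x + t *\<^sub>R y" "- x"] sublinear_scaleR[OF q, of t y] that by simp
  show "sublinear r" unfolding r_def
  proof (rule sublinear_INF)
    show "- q (- x) \<le> q (x + t *\<^sub>R y) - t * q y" if "t \<in> {0..}" for x t
      by (rule lower[OF that])
    show "\<exists>c\<in>{0..}. q (x + z + c *\<^sub>R y) - c * q y \<le>
        q (x + a *\<^sub>R y) - a * q y + (q (z + b *\<^sub>R y) - b * q y)"
      if "a \<in> {0..}" "b \<in> {0..}" for a b x z
      using that sublinear_add[OF q, of "x + a *\<^sub>R y" "z + b *\<^sub>R y"]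
      by (intro bexI[of _ "a + b"]) (auto simp: algebra_simps)
    show "\<exists>b\<in>{0..}. q (c *\<^sub>R x + b *\<^sub>R y) - b * q y \<le> c * (q (x + a *\<^sub>R y) - a * q y)"
      if "a \<in> {0..}" "0 < c" for a c x
      using that sublinear_scaleR[OF q, of c "x + a *\<^sub>R y"]
      by (intro bexI[of _ "c * a"]) (auto simp: algebra_simps)
  qed auto
  show "r x \<le> q (x + t *\<^sub>R y) - t * q y" if "0 \<le> t"
    unfolding r_def by (rule cINF_lower[OF bdd_belowI2[OF lower]]) (use that in auto)
qed

text \<open>Minimality forces the shift of \<open>m\<close> along \<open>y\<close> to be
  \<open>m\<close> itself, and its bound at \<open>t = 1\<close> is then superadditivity.\<close>

lemma minimal_sublinear_linear:
  assumes m: "sublinear m" and min: "\<And>q. sublinear q \<Longrightarrow> q \<le> m \<Longrightarrow> q = m"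
  shows "linear m"
proof -
  have add: "m (x + y) = m x + m y" for x y
  proof (rule antisym[OF sublinear_add[OF m]])
    define r where "r = (\<lambda>x. INF t\<in>{0..}. m (x + t *\<^sub>R y) - t * m y)"
    have r: "sublinear r" "\<And>t x. 0 \<le> t \<Longrightarrow> r x \<le> m (x + t *\<^sub>R y) - t * m y"
      unfolding r_def using sublinear_shift[OF m, where y = y] by blast+
    have "r \<le> m" using r(2)[of 0] by (simp add: le_fun_def)
    then have "r = m" by (rule min[OF r(1)])
    then show "m x + m y \<le> m (x + y)" using r(2)[of 1 x] by simp
  qed
  have neg: "m (- x) = - m x" for x
    using add[of x "- x"] sublinear_zero[OF m] by simp
  have "m (c *\<^sub>R x) = c * m x" for c x
  proof (cases "0 \<le> c")
    case True
    then show ?thesis by (rule sublinear_scaleR[OF m])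
  next
    case False
    then show ?thesis using sublinear_scaleR[OF m, of "- c" x] neg[of "c *\<^sub>R x"] by simp
  qed
  with add show ?thesis by (intro linearI) auto
qed

text \<open>Linear functionals are the minimal sublinear ones, so no extension from subspaces is
  needed.\<close>

lemma sublinear_dominates_linear:
  assumes p: "sublinear p"
  obtains f where "linear f" "\<And>x. f x \<le> p x"
proof -
  define A where "A = {q. sublinear q \<and> q \<le> p}"
  \<comment> \<open>The order is reversed, so that a maximal element in Zorn's lemma is a pointwise
    minimal sublinear functional.\<close>
  define P where "P = (\<lambda>f g :: 'a \<Rightarrow> real. g \<le> f)"
  have "\<exists>m\<in>A. \<forall>a\<in>A. P m a \<longrightarrow> a = m"
  proof (rule predicate_Zorn)
    show "partial_order_on A (relation_of P A)"
      by (rule partial_order_on_relation_ofI) (auto simp: P_def)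
    fix Ch assume Ch: "Ch \<in> Chains (relation_of P A)"
    then have sub: "Ch \<subseteq> A" and total: "\<And>a b. a \<in> Ch \<Longrightarrow> b \<in> Ch \<Longrightarrow> a \<le> b \<or> b \<le> a"
      by (auto simp: Chains_def relation_of_def P_def)
    show "\<exists>u\<in>A. \<forall>a\<in>Ch. P a u"
    proof (cases "Ch = {}")
      case True
      then show ?thesis using p by (auto simp: A_def)
    next
      case False
      define u where "u = (\<lambda>x. INF a\<in>Ch. a x)"
      \<comment> \<open>Domination by \<open>p\<close> also bounds the members of the chain from
        below, so their infimum is finite.\<close>
      have lower: "- p (- x) \<le> a x" if "a \<in> Ch" for a x
      proof -
        have "sublinear a" "a (- x) \<le> p (- x)" using that sub by (auto simp: A_def le_fun_def)
        with sublinear_lower[of a x] show ?thesis by simp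
      qed
      have le: "u x \<le> a x" if "a \<in> Ch" for a x
        unfolding u_def by (rule cINF_lower[OF bdd_belowI2[OF lower] that])
      have "sublinear u" unfolding u_def
      proof (rule sublinear_INF[OF False lower])
        fix a b x y assume ab: "a \<in> Ch" "b \<in> Ch"
        \<comment> \<open>The smaller of \<open>a\<close> and \<open>b\<close> serves at
          \<open>x\<close> and at \<open>y\<close> simultaneously.\<close>
        have "\<exists>c\<in>Ch. c \<le> a \<and> c \<le> b" using total[OF ab] ab by blast
        then obtain c where c: "c \<in> Ch" "c x \<le> a x" "c y \<le> b y" by (auto simp: le_fun_def)
        then have "c (x + y) \<le> a x + b y"
          using sublinear_add[of c x y] sub by (fastforce simp: A_def)
        then show "\<exists>c\<in>Ch. c (x + y) \<le> a x + b y" using c(1) by blast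
      next
        fix a c x assume "a \<in> Ch" "(0::real) < c"
        then show "\<exists>b\<in>Ch. b (c *\<^sub>R x) \<le> c * a x"
          using sublinear_scaleR[of a c x] sub by (intro bexI[of _ a]) (auto simp: A_def)
      qed
      moreover have "u \<le> p"
      proof -
        obtain a where "a \<in> Ch" using False by blast
        then show ?thesis using le[of a] sub by (force simp: A_def le_fun_def intro: order_trans)
      qed
      ultimately show ?thesis using le by (auto simp: A_def P_def le_fun_def)
    qed
  qed
  then obtain m where m: "sublinear m" "m \<le> p" and "\<And>q. sublinear q \<Longrightarrow> q \<le> p \<Longrightarrow> q \<le> m \<Longrightarrow> q = m"
    by (auto simp: A_def P_def)
  then have "linear m" by (intro minimal_sublinear_linear) (auto intro: order_trans)
  then show thesis using m(2) that by (auto simp: le_fun_def)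
qed

text \<open>A linear \<open>f\<close> below the shift of \<open>p\<close> along \<open>y\<close>
  satisfies \<open>f (- y) <= - p y\<close>, which together with \<open>f y <= p y\<close> forces
  equality.\<close>

lemma hahn_banach_sublinear:
  assumes p: "sublinear p"
  obtains f where "linear f" "\<And>x. f x \<le> p x" "f y = p y"
proof -
  define r where "r = (\<lambda>x. INF t\<in>{0..}. p (x + t *\<^sub>R y) - t * p y)"
  have r: "sublinear r" "\<And>t x. 0 \<le> t \<Longrightarrow> r x \<le> p (x + t *\<^sub>R y) - t * p y"
    unfolding r_def using sublinear_shift[OF p, where y = y] by blast+
  obtain f where f: "linear f" "\<And>x. f x \<le> r x" using sublinear_dominates_linear[OF r(1)] by blast
  have le: "f x \<le> p x" for x using f(2)[of x] r(2)[of 0 x] by simp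
  have "f (- y) \<le> - p y"
    using f(2)[of "- y"] r(2)[of 1 "- y"] sublinear_zero[OF p] by simp
  then have "f y = p y" using le[of y] linear_neg[OF f(1), of y] by simp
  with f(1) le show thesis by (rule that)
qed

section \<open>Bounded functionals: separation of cones and subgradients\<close>

text \<open>A one-sided bound on a ball suffices, because the ball is symmetric and
  \<open>f (- x) = - f x\<close>.\<close>

lemma linear_bounded_above_imp_bounded_linear:
  fixes f :: "'a::real_normed_vector \<Rightarrow> real"
  assumes f: "linear f" and d: "0 < d" and le: "\<And>x. norm x < d \<Longrightarrow> f x \<le> B"
  shows "bounded_linear f"
proof (rule bounded_linear_intro)
  show "f (x + y) = f x + f y" for x y by (rule linear_add[OF f])
  show "f (r *\<^sub>R x) = r *\<^sub>R f x" for r x by (rule linear_scale[OF f])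
  have 1: "f x \<le> norm x * (2 * B / d)" for x
  proof (cases "x = 0")
    case True
    then show ?thesis by (simp add: linear_0[OF f])
  next
    case False
    \<comment> \<open>This factor scales \<open>x\<close> to norm \<open>d / 2\<close>, strictly
      inside the ball.\<close>
    define s where "s = d / (2 * norm x)"
    have s: "0 < s" using False d by (simp add: s_def)
    have "norm (s *\<^sub>R x) < d" using False d by (simp add: s_def)
    then have "f (s *\<^sub>R x) \<le> B" by (rule le)
    then have "f x \<le> B / s" using s by (simp add: linear_scale[OF f] field_simps)
    also have "B / s = norm x * (2 * B / d)" using False d by (simp add: s_def field_simps)
    finally show ?thesis .
  qed
  show "norm (f x) \<le> norm x * (2 * B / d)" for x
    using 1[of x] 1[of "- x"] by (simp add: linear_neg[OF f] abs_le_iff)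
qed

text \<open>The distance to a convex cone is sublinear. A linear functional below it and equal to it
  at \<open>y\<close> is at most 0 on \<open>L\<close>, and positive at \<open>y\<close> because
  \<open>L\<close> is closed.\<close>

lemma separate_closed_convex_cone:
  fixes L :: "'a::real_normed_vector set"
  assumes ne: "L \<noteq> {}" and L: "convex L" "cone L" "closed L" and y: "y \<notin> L"
  obtains v :: "'a \<Rightarrow>\<^sub>L real" where "\<And>l. l \<in> L \<Longrightarrow> v l \<le> 0" "0 < v y"
proof -
  define p where "p = (\<lambda>x. INF l\<in>L. dist x l)"
  have p_eq: "p x = infdist x L" for x using ne by (simp add: p_def infdist_def)
  have "sublinear p" unfolding p_def
  proof (rule sublinear_INF[OF ne])
    fix a b x y assume "a \<in> L" "b \<in> L"
    then have "a + b \<in> L" using L(1,2) convex_cone by blast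
    moreover have "dist (x + y) (a + b) \<le> dist x a + dist y b" by (rule dist_triangle_add)
    ultimately show "\<exists>c\<in>L. dist (x + y) c \<le> dist x a + dist y b" by blast
  next
    fix a c x assume "a \<in> L" "(0::real) < c"
    then have "c *\<^sub>R a \<in> L" using L by (simp add: cone_def)
    moreover have "dist (c *\<^sub>R x) (c *\<^sub>R a) \<le> c * dist x a"
      using \<open>0 < c\<close> by (simp add: dist_norm flip: scaleR_diff_right)
    ultimately show "\<exists>b\<in>L. dist (c *\<^sub>R x) b \<le> c * dist x a" by blast
  qed (rule zero_le_dist)
  then obtain f where f: "linear f" "\<And>x. f x \<le> p x" "f y = p y"
    using hahn_banach_sublinear[of p y] by blast
  have "0 \<in> L" using ne L by (simp add: cone_contains_0)
  then have "f x \<le> norm x" for x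
    using infdist_le[of 0 L x] f(2)[of x] by (simp add: p_eq)
  then have "bounded_linear f"
    by (intro linear_bounded_above_imp_bounded_linear[OF f(1), of 1 1])
      (auto intro: order_trans less_imp_le)
  then have app: "blinfun_apply (Blinfun f) = f" by (rule bounded_linear_Blinfun_apply)
  show thesis
  proof
    show "blinfun_apply (Blinfun f) l \<le> 0" if "l \<in> L" for l
      using f(2)[of l] that by (simp add: app p_eq)
    show "0 < blinfun_apply (Blinfun f) y"
      using y ne L infdist_pos_not_in_closed[of L y] by (simp add: app f(3) p_eq)
  qed
qed

text \<open>Convexity makes the directional derivative \<open>q\<close> of \<open>f\<close> at
  \<open>u\<close> sublinear. Any linear functional below \<open>q\<close> is a subgradient, and
  continuity of \<open>f\<close> at \<open>u\<close> makes it bounded.\<close>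

lemma convex_subgradient_exists:
  fixes f :: "'a::real_normed_vector \<Rightarrow> real"
  assumes conv: "convex_on UNIV f" and cont: "continuous_on UNIV f"
  obtains p :: "'a \<Rightarrow>\<^sub>L real" where "\<And>w. f u + p (w - u) \<le> f w"
proof -
  define D where "D = (\<lambda>t x. (f (u + t *\<^sub>R x) - f u) / t)"
  define q where "q = (\<lambda>x. INF t\<in>{0<..}. D t x)"
  \<comment> \<open>The point \<open>u\<close> lies between \<open>u - x\<close> and
    \<open>u + t x\<close>, where the latter has weight \<open>1 / (1 + t)\<close>. Convexity thus
    bounds the difference quotients below uniformly in \<open>t\<close>.\<close>
  have lower: "- D 1 (- x) \<le> D t x" if "t \<in> {0<..}" for t x
  proof -
    have t: "0 < t" using that by simp
    define s where "s = 1 / (1 + t)"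
    have s: "0 \<le> s" "s \<le> 1" "1 - s = t * s" "0 < s" using t by (auto simp: s_def field_simps)
    have "(1 - s) *\<^sub>R (u - x) + s *\<^sub>R (u + t *\<^sub>R x) = u"
    proof -
      have "(1 - s) *\<^sub>R (u - x) + s *\<^sub>R (u + t *\<^sub>R x) = u + (t * s - (1 - s)) *\<^sub>R x"
        by (simp add: algebra_simps)
      then show ?thesis using s(3) by simp
    qed
    then have "f u \<le> (1 - s) * f (u - x) + s * f (u + t *\<^sub>R x)"
      using convex_onD[OF conv, of s "u - x" "u + t *\<^sub>R x"] s by simp
    then have "f u \<le> (t * f (u - x) + f (u + t *\<^sub>R x)) * s"
      by (simp add: s(3) algebra_simps)
    then have "f u * (1 + t) \<le> t * f (u - x) + f (u + t *\<^sub>R x)"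
      using t by (simp add: s_def field_simps)
    then show ?thesis using t by (simp add: D_def field_simps)
  qed
  have "sublinear q" unfolding q_def
  proof (rule sublinear_INF[OF _ lower])
    fix a b :: real and x y assume "a \<in> {0<..}" "b \<in> {0<..}"
    then have ab: "0 < a" "0 < b" by auto
    \<comment> \<open>The weight \<open>s\<close> and the step \<open>r\<close> are chosen so that
      the convex combination of \<open>u + a x\<close> and \<open>u + b y\<close> is exactly
      \<open>u + r (x + y)\<close>.\<close>
    define s r where "s = a / (a + b)" and "r = a * b / (a + b)"
    have s: "0 \<le> s" "s \<le> 1" and r: "0 < r" using ab by (auto simp: s_def r_def)
    have eqs: "(1 - s) * a = r" "s * b = r" using ab by (auto simp: s_def r_def field_simps)
    have coef: "(1 - s) / r = 1 / a" "s / r = 1 / b"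
      using ab r eqs by (simp_all add: field_simps)
    have "(1 - s) *\<^sub>R (u + a *\<^sub>R x) + s *\<^sub>R (u + b *\<^sub>R y)
        = u + (((1 - s) * a) *\<^sub>R x + (s * b) *\<^sub>R y)"
      by (simp add: algebra_simps)
    also have "\<dots> = u + r *\<^sub>R (x + y)" by (simp only: eqs scaleR_add_right)
    finally have "f (u + r *\<^sub>R (x + y)) \<le> (1 - s) * f (u + a *\<^sub>R x) + s * f (u + b *\<^sub>R y)"
      using convex_onD[OF conv, of s "u + a *\<^sub>R x" "u + b *\<^sub>R y"] s by simp
    then have "f (u + r *\<^sub>R (x + y)) - f u \<le>
        (1 - s) * (f (u + a *\<^sub>R x) - f u) + s * (f (u + b *\<^sub>R y) - f u)"
      by (simp add: algebra_simps)
    then have "D r (x + y) \<le> ((1 - s) * (f (u + a *\<^sub>R x) - f u) + s * (f (u + b *\<^sub>R y) - f u)) / r"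
      unfolding D_def using r by (intro divide_right_mono) auto
    also have "\<dots> = (1 - s) / r * (f (u + a *\<^sub>R x) - f u) + s / r * (f (u + b *\<^sub>R y) - f u)"
      by (simp add: add_divide_distrib)
    also have "\<dots> = D a x + D b y" by (simp add: coef D_def)
    finally show "\<exists>c\<in>{0<..}. D c (x + y) \<le> D a x + D b y" using r by auto
  next
    fix a c :: real and x assume "a \<in> {0<..}" "0 < c"
    then show "\<exists>b\<in>{0<..}. D b (c *\<^sub>R x) \<le> c * D a x"
      by (intro bexI[of _ "a / c"]) (auto simp: D_def field_simps)
  qed (auto intro: exI[of _ 1])
  then obtain g where g: "linear g" "\<And>x. g x \<le> q x" using sublinear_dominates_linear by blast
  have g_le: "g x \<le> f (u + x) - f u" for x
  proof -
    have "q x \<le> D 1 x" unfolding q_def by (rule cINF_lower[OF bdd_belowI2[OF lower]]) auto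
    with g(2)[of x] show ?thesis by (simp add: D_def)
  qed
  obtain d where d: "0 < d" "\<And>w. dist w u < d \<Longrightarrow> dist (f w) (f u) < 1"
    using cont unfolding continuous_on_iff by (metis UNIV_I zero_less_one)
  have "bounded_linear g"
  proof (rule linear_bounded_above_imp_bounded_linear[OF g(1) d(1)])
    show "g x \<le> 1" if "norm x < d" for x
      using g_le[of x] d(2)[of "u + x"] that by (simp add: dist_norm)
  qed
  then have app: "blinfun_apply (Blinfun g) = g" by (rule bounded_linear_Blinfun_apply)
  show thesis
    using that[of "Blinfun g"] g_le[of "_ - u"] by (simp add: app algebra_simps)
qed

subsection \<open>Moreau envelopes\<close>

lemma moreau_envelope_le: "moreau_envelope lam f u \<le> f u"
  unfolding moreau_envelope_def by (rule INF_lower2[of u]) (simp_all add: zero_ereal_def[symmetric])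

text \<open>The envelope is monotone in \<open>f\<close>, and the lower bound is the envelope of the
  affine minorant at \<open>u\<close>.\<close>

lemma moreau_envelope_ge_affine:
  fixes p :: "'a::real_inner \<Rightarrow>\<^sub>L real"
  assumes lam: "0 < lam" and le: "\<And>w. ereal (a + p (w - u\<^sub>0)) \<le> f w"
  shows "ereal (a + p (u - u\<^sub>0) - lam / 2 * (norm p)\<^sup>2) \<le> moreau_envelope lam f u"
  unfolding moreau_envelope_def
proof (rule INF_greatest)
  fix w
  let ?n = "norm (u - w)"
  have "p (u - u\<^sub>0) = p (w - u\<^sub>0) + p (u - w)"
    by (simp add: blinfun.diff_right)
  moreover have "p (u - w) \<le> norm p * ?n"
    using norm_blinfun[of p "u - w"] by simp
  \<comment> \<open>Young's inequality, by completing the square.\<close>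
  moreover have "norm p * ?n \<le> lam / 2 * (norm p)\<^sup>2 + 1 / (2 * lam) * ?n\<^sup>2"
  proof -
    have "0 \<le> (lam * norm p - ?n)\<^sup>2 / (2 * lam)" using lam by simp
    also have "\<dots> = lam / 2 * (norm p)\<^sup>2 + 1 / (2 * lam) * ?n\<^sup>2 - norm p * ?n"
      using lam by (simp add: field_simps power2_eq_square)
    finally show ?thesis by simp
  qed
  ultimately have "ereal (a + p (u - u\<^sub>0) - lam / 2 * (norm p)\<^sup>2) \<le>
      ereal (a + p (w - u\<^sub>0)) + ereal (1 / (2 * lam) * ?n\<^sup>2)"
    by simp
  also have "\<dots> \<le> f w + ereal (1 / (2 * lam) * ?n\<^sup>2)"
    by (rule add_right_mono[OF le])
  finally show "ereal (a + p (u - u\<^sub>0) - lam / 2 * (norm p)\<^sup>2) \<le>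
      f w + ereal (1 / (2 * lam) * (norm (u - w))\<^sup>2)" .
qed

text \<open>As an infimum of continuous functions, the envelope is upper semicontinuous.\<close>

lemma open_moreau_envelope_less:
  fixes f :: "'a::real_inner \<Rightarrow> ereal"
  shows "open {u. moreau_envelope lam f u < b}"
proof -
  \<comment> \<open>For infinite \<open>f w\<close> the set is empty or the whole space; for finite
    \<open>f w\<close> it is a strict sublevel set of a continuous function.\<close>
  have "open {u. f w + ereal (1 / (2 * lam) * (norm (u - w))\<^sup>2) < b}" for w
    by (cases "f w")
      (auto intro!: open_Collect_less continuous_intros simp del: times_divide_eq_left)
  then have "open (\<Union>w. {u. f w + ereal (1 / (2 * lam) * (norm (u - w))\<^sup>2) < b})" by blast
  also have "(\<Union>w. {u. f w + ereal (1 / (2 * lam) * (norm (u - w))\<^sup>2) < b}) =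
      {u. moreau_envelope lam f u < b}"
    by (auto simp: moreau_envelope_def INF_less_iff)
  finally show ?thesis .
qed

subsection \<open>Hypo-convergence\<close>

text \<open>Reverse Fatou for sets: the tail unions \<open>B n\<close> contain \<open>A n\<close>
  and decrease to the set of points lying in infinitely many \<open>A k\<close>, and a finite
  measure is continuous along them.\<close>

lemma (in finite_measure) limsup_measure_le:
  fixes A :: "nat \<Rightarrow> 'a set"
  assumes A: "\<And>k. A k \<in> sets M" and T: "T \<in> sets M"
    and sub: "\<And>x. \<exists>\<^sub>F k in sequentially. x \<in> A k \<Longrightarrow> x \<in> T"
  shows "limsup (\<lambda>k. ereal (measure M (A k))) \<le> ereal (measure M T)"
proof -
  define B where "B n = (\<Union>k\<in>{n..}. A k)" for n
  have B: "B n \<in> sets M" for n using A by (auto simp: B_def)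
  have "decseq B" unfolding decseq_def B_def by (intro allI impI UN_mono) auto
  then have "(\<lambda>n. measure M (B n)) \<longlonglongrightarrow> measure M (\<Inter>n. B n)"
    using B by (intro finite_Lim_measure_decseq) auto
  then have "limsup (\<lambda>n. ereal (measure M (B n))) = ereal (measure M (\<Inter>n. B n))"
    by (intro lim_imp_Limsup) auto
  moreover have "measure M (A k) \<le> measure M (B k)" for k
    by (rule finite_measure_mono[OF _ B]) (auto simp: B_def)
  then have "limsup (\<lambda>k. ereal (measure M (A k))) \<le> limsup (\<lambda>n. ereal (measure M (B n)))"
    by (intro Limsup_mono always_eventually) simp
  moreover have "measure M (\<Inter>n. B n) \<le> measure M T"
    using sub by (intro finite_measure_mono[OF _ T]) (auto simp: B_def frequently_sequentially Bex_def)
  ultimately show ?thesis by (simp add: order_trans)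
qed

section \<open>From the constraint cone to the limsup of the regularized events\<close>

text \<open>Evaluation at \<open>y\<close> is weak-star continuous, so the inequalities on
  \<open>C\<close> extend to the closed cone it generates, that is, to \<open>dual_cone K\<close>.
  If \<open>- y\<close> were outside \<open>K\<close>, a separating functional would violate
  them.\<close>

lemma mem_uminus_cone_iff:
  fixes K :: "'y::real_normed_vector set"
  assumes K: "K \<noteq> {}" "convex K" "cone K" "closed K"
    and C: "weak_star_topology closure_of (generated_cone C) = dual_cone K"
  shows "y \<in> uminus ` K \<longleftrightarrow> (\<forall>v\<in>C. blinfun_apply v y \<le> 0)"
proof
  have "C \<subseteq> generated_cone C"
    unfolding generated_cone_def by (force intro: exI[of _ 1])
  also have "\<dots> \<subseteq> dual_cone K"
    unfolding C[symmetric] by (rule closure_of_subset) (simp add: strong_operator_topology_topspace)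
  finally have "v \<in> dual_cone K" if "v \<in> C" for v using that by blast
  then show "\<forall>v\<in>C. blinfun_apply v y \<le> 0" if "y \<in> uminus ` K"
    using that by (fastforce simp: dual_cone_def blinfun.minus_right)
next
  assume le: "\<forall>v\<in>C. blinfun_apply v y \<le> 0"
  have "closedin weak_star_topology
      {v \<in> topspace weak_star_topology. blinfun_apply v y \<in> {..0}}"
    by (rule closedin_continuous_map_preimage[OF strong_operator_topology_continuous_evaluation])
      simp
  then have closed: "closedin weak_star_topology {v. blinfun_apply v y \<le> 0}"
    by (simp add: strong_operator_topology_topspace)
  have "generated_cone C \<subseteq> {v. blinfun_apply v y \<le> 0}"
    using le by (auto simp: generated_cone_def blinfun.scaleR_left mult_nonneg_nonpos)
  from closure_of_minimal[OF this closed]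
  have dual: "blinfun_apply v y \<le> 0" if "v \<in> dual_cone K" for v using that C by auto
  have "- y \<in> K"
  proof (rule ccontr)
    assume "- y \<notin> K"
    then obtain v :: "'y \<Rightarrow>\<^sub>L real" where v: "\<And>l. l \<in> K \<Longrightarrow> v l \<le> 0" "0 < v (- y)"
      using separate_closed_convex_cone[OF K] by blast
    have "- v \<in> dual_cone K" using v(1) by (simp add: dual_cone_def blinfun.minus_left)
    from dual[OF this] v(2) show False by (simp add: blinfun.minus_left blinfun.minus_right)
  qed
  then show "y \<in> uminus ` K" by force
qed

text \<open>Convergence of \<open>h\<close> along \<open>xs\<close> is a separate premise, so that
  the limsup bound serves strongly convergent sequences as well as weakly convergent ones when
  \<open>h\<close> is weakly continuous.\<close>

lemma inner_regularization_hypo: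
  fixes M :: "'\<omega> measure"
    and \<xi> :: "'\<omega> \<Rightarrow> 'z::euclidean_space"
    and \<Phi> :: "'h::real_inner \<times> 'z \<Rightarrow> 'y::real_normed_vector"
    and K :: "'y set"
  assumes "finite_measure M" and \<xi>[measurable]: "\<xi> \<in> borel_measurable M"
    and K: "K \<noteq> {}" "convex K" "cone K" "closed K"
    and C: "weak_star_topology closure_of (generated_cone C) = dual_cone K"
    and \<Phi>: "continuous_on UNIV \<Phi>" and h: "continuous_on UNIV h"
    and conv: "\<And>v. v \<in> C \<Longrightarrow> convex_on UNIV (\<lambda>(x, z). blinfun_apply v (\<Phi> (x, z)) + h x)"
    and lam: "\<And>k::nat. 0 < lam k" "lam \<longlonglongrightarrow> 0"
  shows probability_function_le_inner_regularization:
      "probability_function M \<xi> \<Phi> K x \<le> inner_regularization M \<xi> \<Phi> C h (lam k) x"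
    and limsup_inner_regularization_le:
      "limitin weak_topology xs x sequentially \<Longrightarrow> (\<lambda>k. h (xs k)) \<longlonglongrightarrow> h x \<Longrightarrow>
        limsup (\<lambda>k. ereal (inner_regularization M \<xi> \<Phi> C h (lam k) (xs k))) \<le>
          ereal (probability_function M \<xi> \<Phi> K x)"
proof -
  interpret finite_measure M by fact
  note mem = mem_uminus_cone_iff[OF K C]
  define S where "S = supremum_function C \<Phi> h"
  define E where "E k y = {\<omega> \<in> space M. moreau_envelope (lam k) S (y, \<xi> \<omega>) \<le> ereal (h y)}"
    for k y
  have E: "E k y \<in> sets M" for k y
  proof -
    \<comment> \<open>Sections of an upper semicontinuous function are upper semicontinuous, hence
      Borel.\<close>
    have "(\<lambda>z. moreau_envelope (lam k) S (y, z)) \<in> borel_measurable borel"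
    proof (rule borel_measurableI_less)
      fix b
      have "open ((\<lambda>z. (y, z)) -` {u. moreau_envelope (lam k) S u < b})"
        by (intro open_vimage open_moreau_envelope_less continuous_intros)
      then show "{z \<in> space borel. moreau_envelope (lam k) S (y, z) < b} \<in> sets borel"
        by (simp add: vimage_def)
    qed
    from measurable_compose[OF \<xi> this] show ?thesis unfolding E_def by measurable
  qed
  define T where "T y = {\<omega> \<in> space M. \<Phi> (y, \<xi> \<omega>) \<in> uminus ` K}" for y
  have T: "T y \<in> sets M" for y
  proof -
    have "continuous_on UNIV (\<lambda>z. \<Phi> (y, z))"
      by (rule continuous_on_compose2[OF \<Phi>]) (auto intro!: continuous_intros)
    then have "closed ((\<lambda>z. \<Phi> (y, z)) -` (uminus ` K))"
      using K(4) by (intro closed_vimage closed_negations) auto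
    then have "\<xi> -` ((\<lambda>z. \<Phi> (y, z)) -` (uminus ` K)) \<inter> space M \<in> sets M"
      by (intro measurable_sets[OF \<xi>]) auto
    also have "\<xi> -` ((\<lambda>z. \<Phi> (y, z)) -` (uminus ` K)) \<inter> space M = T y"
      by (auto simp: T_def)
    finally show ?thesis .
  qed
  have reg: "inner_regularization M \<xi> \<Phi> C h (lam k) y = measure M (E k y)" for k y
    by (simp add: inner_regularization_def E_def S_def)
  have prob: "probability_function M \<xi> \<Phi> K y = measure M (T y)" for y
    by (simp add: probability_function_def T_def)
  have "S (y, z) \<le> ereal (h y)" if "\<Phi> (y, z) \<in> uminus ` K" for y z
    using that by (auto simp: S_def supremum_function_def mem intro!: SUP_least)
  then have "T y \<subseteq> E k y" for y k
    using order_trans[OF moreau_envelope_le] unfolding T_def E_def by blast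
  then show "probability_function M \<xi> \<Phi> K x \<le> inner_regularization M \<xi> \<Phi> C h (lam k) x"
    unfolding reg prob by (rule finite_measure_mono) (rule E)
  assume weak: "limitin weak_topology xs x sequentially" and hx: "(\<lambda>k. h (xs k)) \<longlonglongrightarrow> h x"
  show "limsup (\<lambda>k. ereal (inner_regularization M \<xi> \<Phi> C h (lam k) (xs k))) \<le>
      ereal (probability_function M \<xi> \<Phi> K x)"
    unfolding reg prob
  proof (rule limsup_measure_le)
    show "E k (xs k) \<in> sets M" for k by (rule E)
    show "T x \<in> sets M" by (rule T)
    fix \<omega> assume freq: "\<exists>\<^sub>F k in sequentially. \<omega> \<in> E k (xs k)"
    have \<omega>: "\<omega> \<in> space M" using frequently_ex[OF freq] by (auto simp: E_def)
    define z where "z = \<xi> \<omega>"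
    have "blinfun_apply v (\<Phi> (x, z)) \<le> 0" if v: "v \<in> C" for v
    proof -
      define f where "f = (\<lambda>u. blinfun_apply v (\<Phi> u) + h (fst u))"
      have "convex_on UNIV f" using conv[OF v] by (simp add: f_def case_prod_unfold)
      moreover have "continuous_on UNIV f"
        unfolding f_def
        by (intro continuous_intros \<Phi> continuous_on_compose2[OF h]) auto
      \<comment> \<open>The subgradient is taken at the limit point \<open>(x, z)\<close>. It does
        not depend on \<open>k\<close>, so the term \<open>lam k / 2 * (norm p)^2\<close> below
        tends to 0.\<close>
      ultimately obtain p :: "('h \<times> 'z) \<Rightarrow>\<^sub>L real"
        where p: "\<And>w. f (x, z) + blinfun_apply p (w - (x, z)) \<le> f w"
        using convex_subgradient_exists by blast
      have "ereal (f (x, z) + blinfun_apply p (w - (x, z))) \<le> S w" for w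
      proof -
        have "ereal (f w) \<le> S w"
          using v by (auto simp: S_def supremum_function_def f_def case_prod_unfold intro: SUP_upper)
        with p[of w] show ?thesis by (meson ereal_less_eq(3) order_trans)
      qed
      note bound = moreau_envelope_ge_affine[OF lam(1) this]
      let ?b = "\<lambda>k. f (x, z) + blinfun_apply p ((xs k, z) - (x, z)) - lam k / 2 * (norm p)\<^sup>2"
      have ge: "ereal (?b k) \<le> moreau_envelope (lam k) S (xs k, z)" for k by (rule bound)
      \<comment> \<open>Both points have the same second component \<open>z\<close>, so only this
        functional of the first component matters, and weak convergence of \<open>xs\<close> applies
        to it.\<close>
      have "bounded_linear (\<lambda>y. blinfun_apply p (y, 0))"
        by (intro bounded_linear_blinfun_apply bounded_linear_Pair bounded_linear_ident
            bounded_linear_zero)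
      then have "(\<lambda>k. blinfun_apply p (xs k, 0)) \<longlonglongrightarrow> blinfun_apply p (x, 0)"
        using weak[unfolded limitin_weak_topology, rule_format,
            of "Blinfun (\<lambda>y. blinfun_apply p (y, 0))"]
        by (simp add: bounded_linear_Blinfun_apply)
      then have "(\<lambda>k. blinfun_apply p (xs k, 0) - blinfun_apply p (x, 0)) \<longlonglongrightarrow> 0"
        by (simp add: LIM_zero_iff)
      then have "(\<lambda>k. blinfun_apply p ((xs k, z) - (x, z))) \<longlonglongrightarrow> 0"
        by (simp flip: blinfun.diff_right)
      then have "?b \<longlonglongrightarrow> f (x, z) + 0 - 0 / 2 * (norm p)\<^sup>2"
        by (intro tendsto_intros lam(2)) simp_all
      then have lim: "(\<lambda>k. h (xs k) - ?b k) \<longlonglongrightarrow> h x - f (x, z)"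
        using tendsto_diff[OF hx] by fastforce
      \<comment> \<open>Infinitely many \<open>k\<close> suffice: a convergent sequence that is
        nonnegative infinitely often has a nonnegative limit.\<close>
      have ge_freq: "\<exists>\<^sub>F k in sequentially. 0 \<le> h (xs k) - ?b k"
        using freq
      proof (rule frequently_elim1)
        fix k assume "\<omega> \<in> E k (xs k)"
        then have "moreau_envelope (lam k) S (xs k, z) \<le> ereal (h (xs k))"
          by (simp add: E_def z_def)
        from order_trans[OF ge this] show "0 \<le> h (xs k) - ?b k" by simp
      qed
      have "0 \<le> h x - f (x, z)"
      proof (rule ccontr)
        assume "\<not> 0 \<le> h x - f (x, z)"
        then have "\<forall>\<^sub>F k in sequentially. h (xs k) - ?b k < 0"
          by (intro order_tendstoD(2)[OF lim]) simp
        with ge_freq show False unfolding frequently_def not_le by blast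
      qed
      then show ?thesis by (simp add: f_def)
    qed
    then show "\<omega> \<in> T x" using \<omega> by (simp add: T_def mem z_def)
  qed
qed

theorem corollary3p3:
  fixes M :: "'\<omega> measure"
    and \<xi> :: "'\<omega> \<Rightarrow> real ^ 'm"
    and g :: "real ^ 'm \<Rightarrow> ennreal"
    and \<Phi> :: "'h::{real_inner, polish_space} \<times> (real ^ 'm) \<Rightarrow> 'y::banach"
    and h :: "'h \<Rightarrow> real"
    and K :: "'y set"
    and C :: "('y \<Rightarrow>\<^sub>L real) set"
  assumes "prob_space M"
    and "distributed M lborel \<xi> g"
    and "K \<noteq> {}" and "convex K" and "cone K" and "closed K"
    and "convex C" and "compactin weak_star_topology C"
    and "weak_star_topology closure_of (generated_cone C) = dual_cone K"
    and "continuous_on UNIV \<Phi>"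
    and "continuously_differentiable h" and "convex_on UNIV h"
    and "\<And>v. v \<in> C \<Longrightarrow> convex_on UNIV (\<lambda>(x, z). blinfun_apply v (\<Phi> (x, z)) + h x)"
  shows "(\<forall>lam :: nat \<Rightarrow> real. (\<forall>k. 0 < lam k) \<and> lam \<longlonglongrightarrow> 0 \<longrightarrow>
            hypo_converges (\<lambda>k. inner_regularization M \<xi> \<Phi> C h (lam k))
              (probability_function M \<xi> \<Phi> K)) \<and>
         (continuous_map weak_topology euclidean h \<longrightarrow>
          (\<forall>lam :: nat \<Rightarrow> real. (\<forall>k. 0 < lam k) \<and> lam \<longlonglongrightarrow> 0 \<longrightarrow>
            mosco_hypo_converges (\<lambda>k. inner_regularization M \<xi> \<Phi> C h (lam k))
              (probability_function M \<xi> \<Phi> K)))"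
proof -
  interpret prob_space M by fact
  have \<xi>: "\<xi> \<in> borel_measurable M"
    using distributed_measurable[OF \<open>distributed M lborel \<xi> g\<close>] by simp
  have h: "continuous_on UNIV h"
    using \<open>continuously_differentiable h\<close> unfolding continuously_differentiable_def
    by (blast intro: has_derivative_continuous continuous_at_imp_continuous_on)
  note facts = finite_measure_axioms \<xi> assms(3-6,9,10) h assms(13)
  note le = probability_function_le_inner_regularization[OF facts]
  note limsup = limsup_inner_regularization_le[OF facts]
  have recovery: "\<exists>xs. xs \<longlonglongrightarrow> x \<and> ereal (probability_function M \<xi> \<Phi> K x) \<le>
      liminf (\<lambda>k. ereal (inner_regularization M \<xi> \<Phi> C h (lam k) (xs k)))"
    if "\<forall>k. 0 < lam k" "lam \<longlonglongrightarrow> 0" for lam :: "nat \<Rightarrow> real" and x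
    using le[of lam] that
    by (intro exI[of _ "\<lambda>_. x"] conjI tendsto_const Liminf_bounded always_eventually) auto
  \<comment> \<open>Norm convergence implies weak convergence, so the limsup bound for weak limits
    also yields the norm version.\<close>
  have weak: "limitin weak_topology xs x sequentially" if "xs \<longlonglongrightarrow> x" for xs and x :: 'h
    unfolding limitin_weak_topology using that by (auto intro!: tendsto_intros)
  have strong: "(\<lambda>k. h (xs k)) \<longlonglongrightarrow> h x" if "xs \<longlonglongrightarrow> x" for xs x
    using continuous_on_tendsto_compose[OF h that] by simp
  have weak_h: "(\<lambda>k. h (xs k)) \<longlonglongrightarrow> h x"
    if "continuous_map weak_topology euclidean h" "limitin weak_topology xs x sequentially" for xs x
    using continuous_map_limit[OF that] by (simp add: o_def)
  show ?thesis
    unfolding hypo_converges_def mosco_hypo_converges_def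
    by (intro conjI allI impI; (elim conjE)?)
      (auto intro!: recovery limsup intro: weak strong weak_h)
qed

end
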